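(* Let $\omega$ be irrational and let $f:\mathbb{T}\times[a,b]\to\mathbb{T}\times[a,b]$, $f(\theta,\xi)=(\theta+\omega,f_\theta(\xi))$, be a quasiperiodically forced monotone interval map. Let $\mathcal{K}:=\bigcap_{n\in\mathbb{N}}f^n(\mathbb{T}\times[a,b])$ be its global attractor, and let $\varphi^+(\theta):=\sup\mathcal{K}_\theta$ and $\varphi^-(\theta):=\inf\mathcal{K}_\theta$ be its upper and lower bounding graphs. Suppose that $\mathcal{K}$ is pinched. If $\varphi^+$ and $\varphi^-$ are both non-continuous, then $f$ has sensitive dependence on initial conditions on $\mathbb{T}\times[a,b]$. The same conclusion holds if one of the two bounding graphs is non-continuous while the other one is continuous but coincides with one of the boundaries $\mathbb{T}\times\{a\}$, $\mathbb{T}\times\{b\}$ of the annulus $\mathbb{T}\times[a,b]$.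
   Context: $\mathbb{T}=\mathbb{R}/\mathbb{Z}$ is the circle. A quasiperiodically forced monotone interval map is a continuous map $f:\mathbb{T}\times[a,b]\to\mathbb{T}\times[a,b]$ of the form $f(\theta,\xi)=(\theta+\omega,f_\theta(\xi))$ with $\omega$ irrational, such that every fiber map $f_\theta:[a,b]\to[a,b]$ is monotone increasing (non-decreasing). For $\mathcal{K}\subseteq\mathbb{T}\times[a,b]$ put $\mathcal{K}_\theta:=\{\xi:(\theta,\xi)\in\mathcal{K}\}$; $\mathcal{K}$ is pinched if $\mathcal{K}_\theta$ is a single point for some $\theta$. A map $g:Y\to Y$ of a metric space $(Y,d)$ has sensitive dependence on initial conditions if there is $\varepsilon>0$ such that for all $\delta>0$ and $x\in Y$ there exist $n\ge 0$ and $y\in Y$ with $d(x,y)<\delta$ and $d(g^n(x),g^n(y))>\varepsilon$. *)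

theory Defs
  imports "HOL-Analysis.Analysis"
begin

quotient_type circle = real / "\<lambda>x y. x - y \<in> \<int>"
  morphisms rep_circle to_circle
proof (rule equivpI)
  show "reflp (\<lambda>x y::real. x - y \<in> \<int>)"
    by (simp add: reflp_def)
  show "symp (\<lambda>x y::real. x - y \<in> \<int>)"
    unfolding symp_def by (metis Ints_minus minus_diff_eq)
  show "transp (\<lambda>x y::real. x - y \<in> \<int>)"
    unfolding transp_def using Ints_add by fastforce
qed

instantiation circle :: ab_group_add
begin

lift_definition zero_circle :: circle is 0 .

lift_definition plus_circle :: "circle \<Rightarrow> circle \<Rightarrow> circle" is "(+)"
proof -
  fix x x' y y' :: real
  assume "x - x' \<in> \<int>" "y - y' \<in> \<int>"
  then have "(x - x') + (y - y') \<in> \<int>" by (rule Ints_add)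
  then show "(x + y) - (x' + y') \<in> \<int>" by (simp add: algebra_simps)
qed

lift_definition uminus_circle :: "circle \<Rightarrow> circle" is uminus
proof -
  fix x x' :: real
  assume "x - x' \<in> \<int>"
  then have "- (x - x') \<in> \<int>" by (rule Ints_minus)
  then show "- x - - x' \<in> \<int>" by simp
qed

lift_definition minus_circle :: "circle \<Rightarrow> circle \<Rightarrow> circle" is "(-)"
proof -
  fix x x' y y' :: real
  assume "x - x' \<in> \<int>" "y - y' \<in> \<int>"
  then have "(x - x') - (y - y') \<in> \<int>" by (rule Ints_diff)
  then show "(x - y) - (x' - y') \<in> \<int>" by (simp add: algebra_simps)
qed

instance
  by standard (transfer; simp)+

end

instantiation circle :: metric_space
begin

text \<open>The distance on the circle is induced by the distance from \<^term>\<open>x - y\<close> to the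
  nearest integer.\<close>

lift_definition dist_circle :: "circle \<Rightarrow> circle \<Rightarrow> real"
  is "\<lambda>x y. \<bar>(x - y) - of_int (round (x - y))\<bar>"
proof -
  fix x x' y y' :: real
  assume "x - x' \<in> \<int>" "y - y' \<in> \<int>"
  then have "(x - x') - (y - y') \<in> \<int>" by (rule Ints_diff)
  then obtain k where "(x - x') - (y - y') = of_int k" by (rule Ints_cases)
  then have k: "x - y = (x' - y') + of_int k" by simp
  have "x - y + 1/2 = (x' - y' + 1/2) + of_int k" using k by simp
  then have "round (x - y) = round (x' - y') + k"
    by (simp only: round_def floor_add_int)
  then show "\<bar>x - y - of_int (round (x - y))\<bar> = \<bar>x' - y' - of_int (round (x' - y'))\<bar>"
    using k by simp
qed

definition uniformity_circle :: "(circle \<times> circle) filter"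
  where "uniformity_circle = (INF e\<in>{0<..}. principal {(x, y). dist x y < e})"

definition open_circle :: "circle set \<Rightarrow> bool"
  where "open_circle U \<longleftrightarrow> (\<forall>x\<in>U. \<forall>\<^sub>F (x', y) in uniformity. x' = x \<longrightarrow> y \<in> U)"

instance
proof
  fix x y z :: circle
  show "dist x y = 0 \<longleftrightarrow> x = y"
  proof (transfer, goal_cases)
    case (1 x y)
    show ?case
      by (auto elim!: Ints_cases) (metis Ints_of_int)
  qed
  show "dist x y \<le> dist x z + dist y z"
  proof (transfer, goal_cases)
    case (1 x y z)
    have "\<bar>x - y - of_int (round (x - y))\<bar>
        \<le> \<bar>x - y - of_int (round (x - z) - round (y - z))\<bar>"
      by (rule round_diff_minimal)
    also have "\<dots> \<le> \<bar>x - z - of_int (round (x - z))\<bar> + \<bar>y - z - of_int (round (y - z))\<bar>"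
      by simp
    finally show ?case .
  qed
qed (rule uniformity_circle_def open_circle_def)+

end

lemma dist_to_circle_le: "dist (to_circle x) (to_circle y) \<le> dist x y"
  using round_diff_minimal[of "x - y" 0] by (simp add: dist_circle.abs_eq dist_real_def)

text \<open>The metric induces the quotient topology of the real line modulo the integers.\<close>

lemma open_circle_iff_open_vimage: "open U \<longleftrightarrow> open (to_circle -` U)"
proof
  assume U: "open U"
  have "continuous_on UNIV to_circle"
    unfolding continuous_on_iff by (meson dist_to_circle_le order_le_less_trans)
  then show "open (to_circle -` U)"
    using U by (simp add: continuous_on_open_vimage)
next
  assume U: "open (to_circle -` U)"
  show "open U"
    unfolding open_dist
  proof
    fix p assume "p \<in> U"
    obtain x where x: "p = to_circle x"
      using Quotient_abs_rep[OF Quotient_circle] by metis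
    obtain e where e: "e > 0" "\<And>y. dist y x < e \<Longrightarrow> y \<in> to_circle -` U"
      using U \<open>p \<in> U\<close> x unfolding open_dist by (metis vimageI)
    have "q \<in> U" if q: "dist q p < e" for q
    proof -
      obtain y where y: "q = to_circle y"
        using Quotient_abs_rep[OF Quotient_circle] by metis
      define k where "k = round (y - x)"
      have "dist (y - of_int k) x < e"
        using q unfolding x y k_def by (simp add: dist_circle.abs_eq dist_real_def algebra_simps)
      moreover have "to_circle (y - of_int k) = q"
        unfolding y by (simp add: circle.abs_eq_iff)
      ultimately show ?thesis using e(2) by auto
    qed
    with e(1) show "\<exists>e>0. \<forall>q. dist q p < e \<longrightarrow> q \<in> U" by blast
  qed
qed

text \<open>Maps of the annulus are total functions on \<^typ>\<open>circle \<times> real\<close>, and all conditions are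
  relativised to \<^term>\<open>UNIV \<times> {a..b}\<close>. The fiber map over \<open>\<theta>\<close> is
  \<^term>\<open>\<lambda>\<xi>. snd (f (\<theta>, \<xi>))\<close>.\<close>

definition qpf_monotone_interval_map ::
  "real \<Rightarrow> real \<Rightarrow> real \<Rightarrow> (circle \<times> real \<Rightarrow> circle \<times> real) \<Rightarrow> bool" where
  "qpf_monotone_interval_map \<omega> a b f \<longleftrightarrow>
     \<omega> \<notin> \<rat> \<and>
     continuous_on (UNIV \<times> {a..b}) f \<and>
     f \<in> UNIV \<times> {a..b} \<rightarrow> UNIV \<times> {a..b} \<and>
     (\<forall>\<theta>. \<forall>\<xi>\<in>{a..b}. fst (f (\<theta>, \<xi>)) = \<theta> + to_circle \<omega>) \<and>
     (\<forall>\<theta>. mono_on {a..b} (\<lambda>\<xi>. snd (f (\<theta>, \<xi>))))"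

definition global_attractor ::
  "real \<Rightarrow> real \<Rightarrow> (circle \<times> real \<Rightarrow> circle \<times> real) \<Rightarrow> (circle \<times> real) set" where
  "global_attractor a b f = (\<Inter>n. (f ^^ n) ` (UNIV \<times> {a..b}))"

definition fiber :: "(circle \<times> real) set \<Rightarrow> circle \<Rightarrow> real set" where
  "fiber K \<theta> = {\<xi>. (\<theta>, \<xi>) \<in> K}"

definition upper_graph :: "(circle \<times> real) set \<Rightarrow> circle \<Rightarrow> real" where
  "upper_graph K \<theta> = Sup (fiber K \<theta>)"

definition lower_graph :: "(circle \<times> real) set \<Rightarrow> circle \<Rightarrow> real" where
  "lower_graph K \<theta> = Inf (fiber K \<theta>)"

definition pinched :: "(circle \<times> real) set \<Rightarrow> bool" where
  "pinched K \<longleftrightarrow> (\<exists>\<theta>. is_singleton (fiber K \<theta>))"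

definition sensitive_dependence_on :: "'a::metric_space set \<Rightarrow> ('a \<Rightarrow> 'a) \<Rightarrow> bool" where
  "sensitive_dependence_on Y g \<longleftrightarrow>
     (\<exists>\<epsilon>>0. \<forall>\<delta>>0. \<forall>x\<in>Y. \<exists>n. \<exists>y\<in>Y. dist x y < \<delta> \<and> dist ((g ^^ n) x) ((g ^^ n) y) > \<epsilon>)"

end

theory Submission
  imports Defs "HOL-Analysis.Kronecker_Approximation_Theorem"
begin

text \<open>The upper graph is the decreasing limit of the continuous graphs that arise by iterating
  the upper boundary line (\<open>pullback_tendsto\<close>), so it is invariant and upper
  semicontinuous. If it is discontinuous, it jumps downward near some \<alpha> by a fixed amount e.
  Take a short horizontal segment lying above it. Some late iterate carries the segment over both
  \<alpha> and a nearby \<beta> where the graph is low. Over \<alpha> the image stays above the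
  graph, by monotonicity and invariance; over \<beta> it lies below an iterated boundary line that
  has already come close to the graph. The endpoints are thus torn apart by more than e/2, a
  constant independent of the segment (\<open>separation_above_upper\<close>). Reflecting heights
  gives the same below the lower graph (\<open>separation_below_lower\<close>).

  Pinching makes these regions reach every box: a fiber on which the two graphs meet propagates
  along a dense orbit of the rotation (\<open>pinched_dense\<close>), and a point of such a fiber
  off the graphs lies strictly above both or strictly below both. The triangle inequality then
  yields sensitivity everywhere (\<open>sensitive_dependence\<close>).

  A continuous graph lying on a boundary line must lie on its own side of the annulus, since
  otherwise it would squeeze the other graph to a constant. Then no points lie beyond it and
  separation on that side is vacuous.\<close>

section \<open>Rotations of the circle\<close>

lemma dist_circle_translate: "dist (x + c) (y + c) = dist x (y :: circle)"
  by transfer simp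

lemma dist_circle_translate_diff: "dist (x - c) (y - c) = dist x (y :: circle)"
  by transfer simp

lemma to_circle_add: "to_circle (x + y) = to_circle x + to_circle y"
  by (simp add: plus_circle.abs_eq)

text \<open>Kronecker's theorem, with the first N steps absorbed into the target so that the hitting
  time can be taken arbitrarily late.\<close>

lemma irrational_rotation_dense:
  assumes "\<omega> \<notin> \<rat>" "e > 0"
  obtains n where "n \<ge> N" "dist (x + to_circle (real n * \<omega>)) y < e"
proof -
  obtain r where r: "y - x - to_circle (real N * \<omega>) = to_circle r"
    using Quotient_abs_rep[OF Quotient_circle] by metis
  obtain k where k: "\<bar>frac (real k * \<omega>) - frac r\<bar> < e"
    using Kronecker_approx_1_explicit[OF assms(1), of "frac r" e] assms(2) frac_ge_0 frac_lt_1
    by (metis less_eq_real_def)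
  have frac: "to_circle (frac t) = to_circle t" for t
    by (simp add: circle.abs_eq_iff frac_def)
  have "y = x + to_circle (real N * \<omega>) + to_circle r"
    using r by (simp add: algebra_simps)
  moreover have "x + to_circle (real (k + N) * \<omega>)
      = x + to_circle (real N * \<omega>) + to_circle (real k * \<omega>)"
    by (simp add: distrib_right to_circle_add add_ac)
  ultimately have "dist (x + to_circle (real (k + N) * \<omega>)) y
      = dist (to_circle (real k * \<omega>)) (to_circle r)"
    by (metis add.commute dist_circle_translate)
  also have "\<dots> \<le> dist (frac (real k * \<omega>)) (frac r)"
    using dist_to_circle_le frac by metis
  also have "\<dots> < e"
    using k by (simp add: dist_real_def)
  finally show thesis
    using that[of "k + N"] by simp
qed

text \<open>Two points of the same height are compared with each other, not with (\<theta>, \<xi>):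
  the pair will straddle a jump of a bounding graph, at a place that (\<theta>, \<xi>) itself need
  not approach on either side.\<close>

definition separates ::
  "('a::metric_space \<times> 'b::metric_space \<Rightarrow> 'a \<times> 'b) \<Rightarrow> real \<Rightarrow> 'a \<Rightarrow> 'b \<Rightarrow> bool" where
  "separates f e \<theta> \<xi> \<longleftrightarrow> (\<forall>d>0. \<exists>n \<theta>\<^sub>1 \<theta>\<^sub>2. dist \<theta> \<theta>\<^sub>1 < d \<and> dist \<theta> \<theta>\<^sub>2 < d \<and>
     dist ((f ^^ n) (\<theta>\<^sub>1, \<xi>)) ((f ^^ n) (\<theta>\<^sub>2, \<xi>)) > e)"

lemma separates_mono: "\<lbrakk>separates f e \<theta> \<xi>; e' \<le> e\<rbrakk> \<Longrightarrow> separates f e' \<theta> \<xi>"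
  unfolding separates_def by (meson le_less_trans)

section \<open>Iterates on fibers\<close>

locale qpf_map =
  fixes \<omega> a b :: real and f :: "circle \<times> real \<Rightarrow> circle \<times> real"
  assumes ab: "a < b" and qpf: "qpf_monotone_interval_map \<omega> a b f"
begin

definition shift :: "nat \<Rightarrow> circle" where
  "shift n = to_circle (real n * \<omega>)"

text \<open>The height over \<theta> of the n-th image of the upper boundary line; the orbit starts
  n rotations earlier so as to arrive over \<theta>.\<close>

definition pullback_upper :: "nat \<Rightarrow> circle \<Rightarrow> real" where
  "pullback_upper n \<theta> = snd ((f ^^ n) (\<theta> - shift n, b))"

abbreviation upper :: "circle \<Rightarrow> real" where
  "upper \<equiv> upper_graph (global_attractor a b f)"

lemma shift_add: "shift (m + n) = shift m + shift n"
  by (simp add: shift_def distrib_right to_circle_add)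

lemma shift_0: "shift 0 = 0"
  by (simp add: shift_def zero_circle.abs_eq)

lemma shift_Suc: "shift (Suc n) = shift n + to_circle \<omega>"
  by (simp add: shift_def distrib_right to_circle_add add.commute)

lemma f_in: "\<xi> \<in> {a..b} \<Longrightarrow> snd (f (\<theta>, \<xi>)) \<in> {a..b}"
  using qpf unfolding qpf_monotone_interval_map_def Pi_iff
  by (metis SigmaI UNIV_I mem_Sigma_iff prod.collapse)

lemma f_eq: "\<xi> \<in> {a..b} \<Longrightarrow> f (\<theta>, \<xi>) = (\<theta> + to_circle \<omega>, snd (f (\<theta>, \<xi>)))"
  using qpf unfolding qpf_monotone_interval_map_def by (metis prod.collapse)

lemma f_mono: "\<lbrakk>\<xi> \<in> {a..b}; \<eta> \<in> {a..b}; \<xi> \<le> \<eta>\<rbrakk> \<Longrightarrow> snd (f (\<theta>, \<xi>)) \<le> snd (f (\<theta>, \<eta>))"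
  using qpf unfolding qpf_monotone_interval_map_def mono_on_def by blast

lemma f_cont: "continuous_on (UNIV \<times> {a..b}) f"
  using qpf unfolding qpf_monotone_interval_map_def by blast

lemma irr: "\<omega> \<notin> \<rat>"
  using qpf unfolding qpf_monotone_interval_map_def by blast

lemma funpow_fiber:
  assumes "\<xi> \<in> {a..b}"
  shows "fst ((f ^^ n) (\<theta>, \<xi>)) = \<theta> + shift n \<and> snd ((f ^^ n) (\<theta>, \<xi>)) \<in> {a..b}"
proof (induction n)
  case (Suc n)
  then obtain \<eta> where "(f ^^ n) (\<theta>, \<xi>) = (\<theta> + shift n, \<eta>)" "\<eta> \<in> {a..b}"
    by (metis prod.collapse)
  then show ?case
    using arg_cong[OF f_eq[of \<eta> "\<theta> + shift n"], of fst] f_in[of \<eta> "\<theta> + shift n"]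
    by (simp add: shift_Suc[of n] add.assoc)
qed (use assms in \<open>simp add: shift_0\<close>)

lemmas fst_funpow = funpow_fiber[THEN conjunct1]
  and snd_funpow_in = funpow_fiber[THEN conjunct2]

lemma funpow_eq:
  "\<xi> \<in> {a..b} \<Longrightarrow> (f ^^ n) (\<theta>, \<xi>) = (\<theta> + shift n, snd ((f ^^ n) (\<theta>, \<xi>)))"
  using fst_funpow by (metis prod.collapse)

lemma funpow_mono:
  assumes "\<xi> \<in> {a..b}" "\<eta> \<in> {a..b}" "\<xi> \<le> \<eta>"
  shows "snd ((f ^^ n) (\<theta>, \<xi>)) \<le> snd ((f ^^ n) (\<theta>, \<eta>))"
proof (induction n)
  case (Suc n)
  then have "snd (f (\<theta> + shift n, snd ((f ^^ n) (\<theta>, \<xi>))))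
      \<le> snd (f (\<theta> + shift n, snd ((f ^^ n) (\<theta>, \<eta>))))"
    by (intro f_mono snd_funpow_in assms)
  then show ?case
    using funpow_eq[OF assms(1), of n \<theta>] funpow_eq[OF assms(2), of n \<theta>] by simp
qed (use assms in simp)

lemma funpow_cont: "continuous_on (UNIV \<times> {a..b}) (f ^^ n)"
proof (induction n)
  case 0
  then show ?case by (simp add: id_def)
next
  case (Suc n)
  have "(f ^^ n) ` (UNIV \<times> {a..b}) \<subseteq> UNIV \<times> {a..b}"
    using snd_funpow_in
    by (intro image_subsetI) (auto simp: mem_Times_iff simp del: atLeastAtMost_iff)
  then show ?case
    unfolding funpow.simps by (intro continuous_on_compose Suc continuous_on_subset[OF f_cont])
qed

section \<open>The upper bounding graph as a limit of iterated boundary lines\<close>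

lemma pullback_in: "pullback_upper n \<theta> \<in> {a..b}"
  unfolding pullback_upper_def using ab by (intro snd_funpow_in) simp

lemma pullback_cont: "continuous_on UNIV (pullback_upper n)"
proof -
  have "continuous_on UNIV (\<lambda>\<theta>. \<theta> - shift n)"
    unfolding continuous_on_iff by (metis dist_circle_translate_diff)
  then have "continuous_on UNIV (\<lambda>\<theta>. (f ^^ n) (\<theta> - shift n, b))"
    using ab by (intro continuous_on_compose2[OF funpow_cont[of n]] continuous_intros) auto
  then show ?thesis
    unfolding pullback_upper_def by (intro continuous_intros)
qed

text \<open>After its first m - n steps the orbit sits over \<theta> - \<open>shift n\<close> at
  some height in the interval, and n steps remain. This gives both the monotonicity of the pullbacks
  in n and, in the limit, membership in the attractor.\<close>

lemma pullback_mem: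
  assumes "n \<le> m"
  shows "pullback_upper m \<theta> \<in> (\<lambda>\<xi>. snd ((f ^^ n) (\<theta> - shift n, \<xi>))) ` {a..b}"
proof -
  let ?\<eta> = "snd ((f ^^ (m - n)) (\<theta> - shift m, b))"
  have "shift m = shift (m - n) + shift n"
    using shift_add[of "m - n" n] assms by simp
  then have "(f ^^ (m - n)) (\<theta> - shift m, b) = (\<theta> - shift n, ?\<eta>)"
    using funpow_eq[of b "m - n" "\<theta> - shift m"] ab by (simp add: algebra_simps)
  moreover have "(f ^^ m) = (f ^^ n) \<circ> (f ^^ (m - n))"
    using assms by (simp flip: funpow_add)
  ultimately have "pullback_upper m \<theta> = snd ((f ^^ n) (\<theta> - shift n, ?\<eta>))"
    unfolding pullback_upper_def by simp
  moreover have "?\<eta> \<in> {a..b}"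
    using ab by (intro snd_funpow_in) simp
  ultimately show ?thesis by blast
qed

lemma funpow_le_pullback:
  "\<xi> \<in> {a..b} \<Longrightarrow> snd ((f ^^ n) (\<theta>, \<xi>)) \<le> pullback_upper n (\<theta> + shift n)"
  unfolding pullback_upper_def using ab by (simp add: funpow_mono)

lemma pullback_decseq: "decseq (\<lambda>n. pullback_upper n \<theta>)"
proof (rule decseq_SucI)
  fix n
  obtain \<xi> where "\<xi> \<in> {a..b}" "pullback_upper (Suc n) \<theta> = snd ((f ^^ n) (\<theta> - shift n, \<xi>))"
    using pullback_mem[of n "Suc n" \<theta>] by auto
  then show "pullback_upper (Suc n) \<theta> \<le> pullback_upper n \<theta>"
    using funpow_le_pullback[of \<xi> n "\<theta> - shift n"] by simp
qed

text \<open>The base map is invertible, so the n-th image of the annulus meets the fiber over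
  \<theta> only in the image of the fiber over \<theta> - \<open>shift n\<close>; the attractor can
  be studied one fiber at a time.\<close>

lemma mem_attractor:
  "(\<theta>, \<xi>) \<in> global_attractor a b f
     \<longleftrightarrow> (\<forall>n. \<xi> \<in> (\<lambda>\<eta>. snd ((f ^^ n) (\<theta> - shift n, \<eta>))) ` {a..b})"
proof -
  have "(\<theta>, \<xi>) \<in> (f ^^ n) ` (UNIV \<times> {a..b})
      \<longleftrightarrow> \<xi> \<in> (\<lambda>\<eta>. snd ((f ^^ n) (\<theta> - shift n, \<eta>))) ` {a..b}" for n
  proof
    assume "(\<theta>, \<xi>) \<in> (f ^^ n) ` (UNIV \<times> {a..b})"
    then obtain \<theta>' \<eta> where *: "(f ^^ n) (\<theta>', \<eta>) = (\<theta>, \<xi>)" "\<eta> \<in> {a..b}" by force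
    then have "\<theta>' = \<theta> - shift n"
      using fst_funpow[of \<eta> n \<theta>'] by simp
    with * show "\<xi> \<in> (\<lambda>\<eta>. snd ((f ^^ n) (\<theta> - shift n, \<eta>))) ` {a..b}"
      by (auto intro!: image_eqI[of _ _ \<eta>])
  next
    assume "\<xi> \<in> (\<lambda>\<eta>. snd ((f ^^ n) (\<theta> - shift n, \<eta>))) ` {a..b}"
    then obtain \<eta> where "\<eta> \<in> {a..b}" "\<xi> = snd ((f ^^ n) (\<theta> - shift n, \<eta>))" by blast
    then have "(f ^^ n) (\<theta> - shift n, \<eta>) = (\<theta>, \<xi>)"
      using funpow_eq[of \<eta> n "\<theta> - shift n"] by simp
    with \<open>\<eta> \<in> {a..b}\<close> show "(\<theta>, \<xi>) \<in> (f ^^ n) ` (UNIV \<times> {a..b})"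
      by (intro image_eqI[of _ _ "(\<theta> - shift n, \<eta>)"]) auto
  qed
  then show ?thesis
    unfolding global_attractor_def by blast
qed

text \<open>The decreasing limit L of the pullbacks lies in the image of every n-fold fiber map,
  because that image is compact and contains all pullbacks from index n on. Every attractor point
  over \<theta> lies below all pullbacks, hence below L. So the supremum is attained and equals
  L.\<close>

lemma upper_mem: "upper \<theta> \<in> fiber (global_attractor a b f) \<theta>"
  and pullback_tendsto: "(\<lambda>n. pullback_upper n \<theta>) \<longlonglongrightarrow> upper \<theta>"
proof -
  obtain L where L: "(\<lambda>n. pullback_upper n \<theta>) \<longlonglongrightarrow> L"
    using decseq_convergent[OF pullback_decseq, where B = a] pullback_in
    by (metis atLeastAtMost_iff)
  have "L \<in> (\<lambda>\<eta>. snd ((f ^^ n) (\<theta> - shift n, \<eta>))) ` {a..b}" for n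
  proof -
    have "continuous_on {a..b} (\<lambda>\<eta>. (f ^^ n) (\<theta> - shift n, \<eta>))"
      by (rule continuous_on_compose2[OF funpow_cont[of n]]) (auto intro!: continuous_intros)
    then have "compact ((\<lambda>\<eta>. snd ((f ^^ n) (\<theta> - shift n, \<eta>))) ` {a..b})"
      by (intro compact_continuous_image continuous_intros) auto
    then have "closed ((\<lambda>\<eta>. snd ((f ^^ n) (\<theta> - shift n, \<eta>))) ` {a..b})"
      by (rule compact_imp_closed)
    moreover have "pullback_upper (m + n) \<theta> \<in> (\<lambda>\<eta>. snd ((f ^^ n) (\<theta> - shift n, \<eta>))) ` {a..b}" for m
      by (rule pullback_mem) simp
    moreover have "(\<lambda>m. pullback_upper (m + n) \<theta>) \<longlonglongrightarrow> L"
      using L by (rule LIMSEQ_ignore_initial_segment)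
    ultimately show ?thesis
      by (rule closed_sequentially)
  qed
  then have mem: "L \<in> fiber (global_attractor a b f) \<theta>"
    by (simp add: fiber_def mem_attractor)
  moreover have "\<xi> \<le> L" if "\<xi> \<in> fiber (global_attractor a b f) \<theta>" for \<xi>
  proof (rule LIMSEQ_le_const[OF L])
    have "\<xi> \<le> pullback_upper n \<theta>" for n
    proof -
      obtain \<eta> where "\<eta> \<in> {a..b}" "\<xi> = snd ((f ^^ n) (\<theta> - shift n, \<eta>))"
        using \<open>\<xi> \<in> _\<close> unfolding fiber_def mem_Collect_eq mem_attractor by blast
      then show ?thesis
        using funpow_le_pullback[of \<eta> n "\<theta> - shift n"] by simp
    qed
    then show "\<exists>N. \<forall>n\<ge>N. \<xi> \<le> pullback_upper n \<theta>" by blast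
  qed
  ultimately have "upper \<theta> = L"
    unfolding upper_graph_def by (rule cSup_eq_maximum)
  with L mem show "upper \<theta> \<in> fiber (global_attractor a b f) \<theta>"
    and "(\<lambda>n. pullback_upper n \<theta>) \<longlonglongrightarrow> upper \<theta>" by simp_all
qed

lemma upper_le_pullback: "upper \<theta> \<le> pullback_upper n \<theta>"
  using decseq_ge[OF pullback_decseq pullback_tendsto] .

lemma upper_in: "upper \<theta> \<in> {a..b}"
proof (rule closed_sequentially[of "{a..b}", OF closed_atLeastAtMost _ pullback_tendsto])
  show "pullback_upper n \<theta> \<in> {a..b}" for n by (rule pullback_in)
qed

text \<open>The fiber map sends the n-th pullback over \<theta> to the pullback of index n + 1 over
  the rotated point; continuity of \<open>f\<close> passes this to the limit.\<close>

lemma upper_invariant: "upper (\<theta> + to_circle \<omega>) = snd (f (\<theta>, upper \<theta>))"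
proof -
  have "(\<lambda>n. f (\<theta>, pullback_upper n \<theta>)) \<longlonglongrightarrow> f (\<theta>, upper \<theta>)"
    using pullback_in upper_in
    by (intro continuous_on_tendsto_compose[OF f_cont] tendsto_intros pullback_tendsto) auto
  then have "(\<lambda>n. snd (f (\<theta>, pullback_upper n \<theta>))) \<longlonglongrightarrow> snd (f (\<theta>, upper \<theta>))"
    by (rule tendsto_snd)
  moreover have "snd (f (\<theta>, pullback_upper n \<theta>)) = pullback_upper (Suc n) (\<theta> + to_circle \<omega>)" for n
    using funpow_eq[of b n "\<theta> - shift n"] ab
    by (simp add: pullback_upper_def shift_Suc[of n] algebra_simps)
  ultimately have "(\<lambda>n. pullback_upper (Suc n) (\<theta> + to_circle \<omega>)) \<longlonglongrightarrow> snd (f (\<theta>, upper \<theta>))"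
    by simp
  then show ?thesis
    using LIMSEQ_Suc[OF pullback_tendsto[of "\<theta> + to_circle \<omega>"]] LIMSEQ_unique by blast
qed

lemma upper_invariant_funpow: "upper (\<theta> + shift n) = snd ((f ^^ n) (\<theta>, upper \<theta>))"
proof (induction n)
  case (Suc n)
  have "upper (\<theta> + shift (Suc n)) = snd (f (\<theta> + shift n, upper (\<theta> + shift n)))"
    by (subst upper_invariant[symmetric]) (simp add: shift_Suc[of n] add.assoc)
  then show ?case
    using Suc funpow_eq[OF upper_in, of n \<theta> \<theta>] by simp
qed (simp add: shift_0)

section \<open>Semicontinuity and separation above the upper graph\<close>

text \<open>A pointwise decreasing limit of continuous functions is upper semicontinuous: a single
  pullback already below c at \<theta> controls a whole neighbourhood.\<close>

lemma upper_usc: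
  assumes "upper \<theta> < c"
  obtains d where "d > 0" "\<And>\<theta>'. dist \<theta>' \<theta> < d \<Longrightarrow> upper \<theta>' < c"
proof -
  obtain n where n: "pullback_upper n \<theta> < c"
    using order_tendstoD(2)[OF pullback_tendsto assms] unfolding eventually_sequentially by blast
  moreover have "isCont (pullback_upper n) \<theta>"
    using pullback_cont by (simp add: continuous_on_eq_continuous_at)
  then have "(pullback_upper n \<longlongrightarrow> pullback_upper n \<theta>) (nhds \<theta>)"
    by (simp add: isCont_def tendsto_at_iff_tendsto_nhds)
  ultimately have "\<forall>\<^sub>F \<theta>' in nhds \<theta>. pullback_upper n \<theta>' < c"
    by (simp add: order_tendstoD(2))
  then obtain d where "d > 0" "\<And>\<theta>'. dist \<theta>' \<theta> < d \<Longrightarrow> pullback_upper n \<theta>' < c"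
    unfolding eventually_nhds_metric by blast
  then show thesis
    using that upper_le_pullback le_less_trans by metis
qed

text \<open>Points above \<open>\<phi>\<^sup>+\<close> never cross it, while over a fixed fiber they are forced down towards it.
  So a horizontal segment above \<open>\<phi>\<^sup>+\<close>, once transported over a downward jump of \<open>\<phi>\<^sup>+\<close>, is torn apart.\<close>
lemma separation_above_upper:
  assumes "\<not> continuous_on UNIV upper"
  shows "\<exists>e>0. \<forall>\<theta>. \<forall>\<xi>\<in>{a..b}. upper \<theta> < \<xi> \<longrightarrow> separates f e \<theta> \<xi>"
proof -
  obtain \<alpha> e where e: "e > 0"
    and jump: "\<And>d. d > 0 \<Longrightarrow> \<exists>\<beta>. dist \<beta> \<alpha> < d \<and> \<bar>upper \<beta> - upper \<alpha>\<bar> \<ge> e"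
    using assms unfolding continuous_on_iff dist_real_def by (metis not_le)
  obtain r where r: "r > 0" "\<And>\<beta>. dist \<beta> \<alpha> < r \<Longrightarrow> upper \<beta> < upper \<alpha> + e"
    using upper_usc[of \<alpha> "upper \<alpha> + e"] e by auto
  \<comment> \<open>Semicontinuity excludes upward jumps near \<alpha>, so the discontinuity must
    show as a drop by e.\<close>
  have drop: "\<exists>\<beta>. dist \<beta> \<alpha> < d \<and> upper \<beta> \<le> upper \<alpha> - e" if "d > 0" for d
  proof -
    obtain \<beta> where "dist \<beta> \<alpha> < min d r" "\<bar>upper \<beta> - upper \<alpha>\<bar> \<ge> e"
      using jump[of "min d r"] \<open>d > 0\<close> r(1) by auto
    then show ?thesis
      using r(2)[of \<beta>] by (intro exI[of _ \<beta>]) auto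
  qed
  have "separates f (e / 2) \<theta> \<xi>" if \<xi>: "upper \<theta> < \<xi>" "\<xi> \<in> {a..b}" for \<theta> \<xi>
    unfolding separates_def
  proof (intro allI impI)
    fix d :: real
    assume "d > 0"
    obtain s where s: "s > 0" "\<And>\<theta>'. dist \<theta>' \<theta> < s \<Longrightarrow> upper \<theta>' < \<xi>"
      using upper_usc[OF \<xi>(1)] by blast
    \<comment> \<open>Both \<alpha> and \<beta>, rotated back by n steps, will be within 2\<rho> of
      \<theta>: one \<rho> for the return to \<alpha>, one for the distance from \<beta> to
      \<alpha>.\<close>
    define \<rho> where "\<rho> = min d s / 2"
    have \<rho>: "\<rho> > 0" "2 * \<rho> \<le> d" "2 * \<rho> \<le> s"
      using \<open>d > 0\<close> s(1) by (auto simp: \<rho>_def)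
    obtain \<beta> where \<beta>: "dist \<beta> \<alpha> < \<rho>" "upper \<beta> \<le> upper \<alpha> - e"
      using drop[OF \<rho>(1)] by blast
    then have "upper \<beta> < upper \<alpha> - e / 2"
      using e by simp
    from order_tendstoD(2)[OF pullback_tendsto this]
    obtain N where N: "\<And>n. n \<ge> N \<Longrightarrow> pullback_upper n \<beta> < upper \<alpha> - e / 2"
      unfolding eventually_sequentially by blast
    \<comment> \<open>The order of choice matters: \<beta> is fixed first, then N from convergence
      at that single \<beta>, and only then a return time n beyond N. Convergence is merely
      pointwise.\<close>
    obtain n where n: "n \<ge> N" "dist (\<theta> + shift n) \<alpha> < \<rho>"
      using irrational_rotation_dense[OF irr \<rho>(1), where N = N and x = \<theta> and y = \<alpha>]
      unfolding shift_def by blast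
    have near: "dist \<theta> (x - shift n) = dist (\<theta> + shift n) x" for x
      using dist_circle_translate_diff[of "\<theta> + shift n" "shift n" x] by simp
    have d\<alpha>: "dist \<theta> (\<alpha> - shift n) < 2 * \<rho>"
      using n(2) near \<rho>(1) by simp
    have d\<beta>: "dist \<theta> (\<beta> - shift n) < 2 * \<rho>"
      using n(2) near[of \<beta>] \<beta>(1) dist_triangle2[of "\<theta> + shift n" \<beta> \<alpha>] by linarith
    \<comment> \<open>Over \<alpha>, invariance and monotonicity keep the image above the graph;
      over \<beta>, the n-th pullback bounds it from above.\<close>
    have "upper (\<alpha> - shift n) \<le> \<xi>"
      using s(2)[of "\<alpha> - shift n"] d\<alpha> \<rho>(3) by (simp add: dist_commute less_imp_le)
    then have "upper \<alpha> \<le> snd ((f ^^ n) (\<alpha> - shift n, \<xi>))"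
      using upper_invariant_funpow[of "\<alpha> - shift n" n] funpow_mono[OF upper_in \<xi>(2)] by simp
    moreover have "snd ((f ^^ n) (\<beta> - shift n, \<xi>)) < upper \<alpha> - e / 2"
      using funpow_le_pullback[OF \<xi>(2), of n "\<beta> - shift n"] N[OF n(1)] by simp
    ultimately have "e / 2 < dist (snd ((f ^^ n) (\<alpha> - shift n, \<xi>))) (snd ((f ^^ n) (\<beta> - shift n, \<xi>)))"
      unfolding dist_real_def by linarith
    also have "\<dots> \<le> dist ((f ^^ n) (\<alpha> - shift n, \<xi>)) ((f ^^ n) (\<beta> - shift n, \<xi>))"
      by (rule dist_snd_le)
    finally show "\<exists>n \<theta>\<^sub>1 \<theta>\<^sub>2. dist \<theta> \<theta>\<^sub>1 < d \<and> dist \<theta> \<theta>\<^sub>2 < d \<and>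
         dist ((f ^^ n) (\<theta>\<^sub>1, \<xi>)) ((f ^^ n) (\<theta>\<^sub>2, \<xi>)) > e / 2"
      using d\<alpha> d\<beta> \<rho>(2) by (meson less_le_trans)
  qed
  then show ?thesis
    using e half_gt_zero by blast
qed

end

section \<open>Reflection of the annulus\<close>

text \<open>An isometric involution; conjugating by it exchanges the roles of the two bounding
  graphs, so results on the lower graph follow from those on the upper one.\<close>

definition flip :: "circle \<times> real \<Rightarrow> circle \<times> real" where
  "flip p = (fst p, - snd p)"

lemma flip_flip [simp]: "flip (flip p) = p"
  by (simp add: flip_def)

lemma dist_flip [simp]: "dist (flip p) (flip q) = dist p q"
  by (simp add: flip_def dist_prod_def dist_real_def power2_commute)

lemma flip_annulus: "flip ` (UNIV \<times> {a..b}) = UNIV \<times> {-b..-a}"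
proof (intro equalityI subsetI)
  fix p :: "circle \<times> real" assume "p \<in> UNIV \<times> {-b..-a}"
  then have "flip p \<in> UNIV \<times> {a..b}"
    by (auto simp: flip_def)
  then show "p \<in> flip ` (UNIV \<times> {a..b})"
    by (metis flip_flip image_eqI)
qed (auto simp: flip_def)

lemma funpow_flip: "((flip \<circ> f \<circ> flip) ^^ n) p = flip ((f ^^ n) (flip p))"
  by (induction n) auto

lemma global_attractor_flip:
  "global_attractor (-b) (-a) (flip \<circ> f \<circ> flip) = flip ` global_attractor a b f"
proof -
  have "((flip \<circ> f \<circ> flip) ^^ n) ` (UNIV \<times> {-b..-a}) = flip ` (f ^^ n) ` (UNIV \<times> {a..b})" for n
    by (simp add: flip_annulus[symmetric] image_image funpow_flip)
  moreover have "inj flip"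
    by (metis injI flip_flip)
  ultimately show ?thesis
    unfolding global_attractor_def by (simp add: image_INT[of flip UNIV])
qed

text \<open>An identity for arbitrary \<open>K\<close>, since \<open>Inf\<close> on the reals is by
  definition the negated \<open>Sup\<close> of the negated set.\<close>

lemma upper_graph_flip: "upper_graph (flip ` K) \<theta> = - lower_graph K \<theta>"
proof -
  have "fiber (flip ` K) \<theta> = uminus ` fiber K \<theta>"
    by (force simp: fiber_def flip_def image_iff)
  then show ?thesis
    by (simp add: upper_graph_def lower_graph_def Inf_real_def)
qed

text \<open>Heights are reversed before and after applying \<open>f\<close>, so the fiber maps
  remain increasing.\<close>

lemma (in qpf_map) qpf_map_flip: "qpf_map \<omega> (-b) (-a) (flip \<circ> f \<circ> flip)"
proof
  show "-b < -a" using ab by simp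
  have flip_cont: "continuous_on S flip" for S
    unfolding flip_def by (intro continuous_intros)
  have "continuous_on (UNIV \<times> {-b..-a}) (flip \<circ> (f \<circ> flip))"
    using f_cont flip_annulus[of "-b" "-a"]
    by (intro continuous_on_compose flip_cont) simp_all
  moreover have "flip \<circ> f \<circ> flip \<in> UNIV \<times> {-b..-a} \<rightarrow> UNIV \<times> {-b..-a}"
    using f_in by (fastforce simp: flip_def)
  moreover have "fst ((flip \<circ> f \<circ> flip) (\<theta>, \<xi>)) = \<theta> + to_circle \<omega>" if "\<xi> \<in> {-b..-a}" for \<theta> \<xi>
    using f_eq[of "-\<xi>" \<theta>] that by (simp add: flip_def prod_eq_iff)
  moreover have "mono_on {-b..-a} (\<lambda>\<xi>. snd ((flip \<circ> f \<circ> flip) (\<theta>, \<xi>)))" for \<theta>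
    using f_mono by (auto simp: mono_on_def flip_def)
  ultimately show "qpf_monotone_interval_map \<omega> (-b) (-a) (flip \<circ> f \<circ> flip)"
    unfolding qpf_monotone_interval_map_def using irr by (simp add: o_assoc)
qed

section \<open>The lower graph, pinching and sensitivity\<close>

context qpf_map
begin

abbreviation lower :: "circle \<Rightarrow> real" where
  "lower \<equiv> lower_graph (global_attractor a b f)"

lemma flip_upper_graph:
  "upper_graph (global_attractor (-b) (-a) (flip \<circ> f \<circ> flip)) \<theta> = - lower \<theta>"
  by (simp add: global_attractor_flip upper_graph_flip)

lemma lower_in: "lower \<theta> \<in> {a..b}"
  using qpf_map.upper_in[OF qpf_map_flip] unfolding flip_upper_graph by auto

lemma lower_invariant_funpow: "lower (\<theta> + shift n) = snd ((f ^^ n) (\<theta>, lower \<theta>))"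
  using qpf_map.upper_invariant_funpow[OF qpf_map_flip]
  unfolding flip_upper_graph qpf_map.shift_def[OF qpf_map_flip] funpow_flip
  by (simp add: shift_def flip_def)

text \<open>Apply \<open>separation_above_upper\<close> to the reflected system; since
  \<open>flip\<close> is an isometry, the same constant serves.\<close>

lemma separation_below_lower:
  assumes "\<not> continuous_on UNIV lower"
  shows "\<exists>e>0. \<forall>\<theta>. \<forall>\<xi>\<in>{a..b}. \<xi> < lower \<theta> \<longrightarrow> separates f e \<theta> \<xi>"
proof -
  have "\<not> continuous_on UNIV (\<lambda>\<theta>. - lower \<theta>)"
    using assms continuous_on_minus[of UNIV "\<lambda>\<theta>. - lower \<theta>"] by auto
  then have "\<not> continuous_on UNIV (upper_graph (global_attractor (-b) (-a) (flip \<circ> f \<circ> flip)))"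
    by (simp add: flip_upper_graph[abs_def])
  from qpf_map.separation_above_upper[OF qpf_map_flip this]
  obtain e where e: "e > 0"
    "\<And>\<theta> \<xi>. \<lbrakk>\<xi> \<in> {-b..-a}; - lower \<theta> < \<xi>\<rbrakk> \<Longrightarrow> separates (flip \<circ> f \<circ> flip) e \<theta> \<xi>"
    unfolding flip_upper_graph by blast
  have "separates f e \<theta> \<xi>" if "\<xi> \<in> {a..b}" "\<xi> < lower \<theta>" for \<theta> \<xi>
    using e(2)[of "-\<xi>" \<theta>] that unfolding separates_def funpow_flip dist_flip
    by (simp add: flip_def)
  with e(1) show ?thesis by blast
qed

lemma lower_le_upper: "lower \<theta> \<le> upper \<theta>"
proof -
  have "a \<le> \<xi>" if "\<xi> \<in> fiber (global_attractor a b f) \<theta>" for \<xi>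
  proof -
    have "\<xi> \<in> (\<lambda>\<eta>. snd ((f ^^ 0) (\<theta> - shift 0, \<eta>))) ` {a..b}"
      using that unfolding fiber_def mem_Collect_eq mem_attractor by blast
    then show ?thesis by auto
  qed
  then have "bdd_below (fiber (global_attractor a b f) \<theta>)"
    by (rule bdd_belowI)
  then show ?thesis
    unfolding lower_graph_def by (intro cInf_lower upper_mem)
qed

text \<open>Both graphs are invariant, so their coincidence on one fiber persists along its forward
  orbit under the rotation, which is dense.\<close>

lemma pinched_dense:
  assumes "pinched (global_attractor a b f)" "d > 0"
  obtains \<theta>' where "dist \<theta> \<theta>' < d" "upper \<theta>' = lower \<theta>'"
proof -
  obtain \<theta>\<^sub>0 \<xi> where "fiber (global_attractor a b f) \<theta>\<^sub>0 = {\<xi>}"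
    using assms(1) unfolding pinched_def is_singleton_def by blast
  then have "upper \<theta>\<^sub>0 = lower \<theta>\<^sub>0"
    by (simp add: upper_graph_def lower_graph_def)
  then have "upper (\<theta>\<^sub>0 + shift n) = lower (\<theta>\<^sub>0 + shift n)" for n
    by (simp add: upper_invariant_funpow lower_invariant_funpow)
  moreover obtain n where "dist (\<theta>\<^sub>0 + shift n) \<theta> < d"
    using irrational_rotation_dense[OF irr assms(2)] unfolding shift_def by metis
  ultimately show thesis
    using that by (metis dist_commute)
qed

text \<open>Pinched fibers are dense, so every box contains a point above \<open>\<phi>\<^sup>+\<close> or below \<open>\<phi>\<^sup>-\<close>.\<close>
lemma sensitive_dependence:
  assumes pinched: "pinched (global_attractor a b f)"
    and above: "\<exists>e>0. \<forall>\<theta>. \<forall>\<xi>\<in>{a..b}. upper \<theta> < \<xi> \<longrightarrow> separates f e \<theta> \<xi>"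
    and below: "\<exists>e>0. \<forall>\<theta>. \<forall>\<xi>\<in>{a..b}. \<xi> < lower \<theta> \<longrightarrow> separates f e \<theta> \<xi>"
  shows "sensitive_dependence_on (UNIV \<times> {a..b}) f"
proof -
  obtain e\<^sub>1 e\<^sub>2 where e12: "e\<^sub>1 > 0" "e\<^sub>2 > 0"
    "\<And>\<theta> \<xi>. \<lbrakk>\<xi> \<in> {a..b}; upper \<theta> < \<xi>\<rbrakk> \<Longrightarrow> separates f e\<^sub>1 \<theta> \<xi>"
    "\<And>\<theta> \<xi>. \<lbrakk>\<xi> \<in> {a..b}; \<xi> < lower \<theta>\<rbrakk> \<Longrightarrow> separates f e\<^sub>2 \<theta> \<xi>"
    using above below by metis
  define e where "e = min e\<^sub>1 e\<^sub>2"
  have e: "e > 0" "e \<le> e\<^sub>1" "e \<le> e\<^sub>2"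
    using e12(1,2) by (auto simp: e_def)
  show ?thesis
    unfolding sensitive_dependence_on_def
  proof (intro exI[of _ "e / 2"] conjI allI impI ballI)
    show "e / 2 > 0" using e(1) by simp
    fix \<delta> :: real and x assume "\<delta> > 0" and "x \<in> (UNIV :: circle set) \<times> {a..b}"
    then obtain \<theta> \<xi> where x: "x = (\<theta>, \<xi>)" "\<xi> \<in> {a..b}" by auto
    \<comment> \<open>Three displacements must add up to less than \<delta>: from \<theta> to the
      pinched fiber, from there to a point of the separated pair, and from \<xi> to \<eta>.\<close>
    define \<rho> where "\<rho> = \<delta> / 3"
    have \<rho>: "\<rho> > 0" using \<open>\<delta> > 0\<close> by (simp add: \<rho>_def)
    obtain \<theta>' where \<theta>': "dist \<theta> \<theta>' < \<rho>" "upper \<theta>' = lower \<theta>'"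
      using pinched_dense[OF pinched \<rho>] by blast
    \<comment> \<open>If \<xi> itself is off the graph it serves as \<eta>; otherwise any other
      nearby height does, which exists because the interval is nondegenerate.\<close>
    obtain \<eta> where \<eta>: "\<eta> \<in> {a..b}" "\<eta> \<noteq> upper \<theta>'" "dist \<xi> \<eta> < \<rho>"
    proof -
      have "\<exists>\<eta>\<in>{a..b}. \<eta> \<noteq> \<xi> \<and> dist \<xi> \<eta> < \<rho>"
      proof (cases "\<xi> < b")
        case True
        then show ?thesis
          using x(2) \<rho> by (intro bexI[of _ "min b (\<xi> + \<rho> / 2)"]) (auto simp: dist_real_def min_def)
      next
        case False
        then show ?thesis
          using x(2) \<rho> ab
          by (intro bexI[of _ "max a (\<xi> - \<rho> / 2)"]) (auto simp: dist_real_def max_def)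
      qed
      then show thesis
        using that x(2) \<rho> by (metis dist_self)
    qed
    \<comment> \<open>On a pinched fiber, avoiding the common value of the graphs means lying
      strictly above the upper or strictly below the lower one.\<close>
    then have "separates f e \<theta>' \<eta>"
      using e12(3)[OF \<eta>(1), of \<theta>', THEN separates_mono, OF _ e(2)]
        e12(4)[OF \<eta>(1), of \<theta>', THEN separates_mono, OF _ e(3)] \<eta>(2) \<theta>'(2) by linarith
    then obtain n \<theta>\<^sub>1 \<theta>\<^sub>2 where n: "dist \<theta>' \<theta>\<^sub>1 < \<rho>" "dist \<theta>' \<theta>\<^sub>2 < \<rho>"
        "dist ((f ^^ n) (\<theta>\<^sub>1, \<eta>)) ((f ^^ n) (\<theta>\<^sub>2, \<eta>)) > e"
      unfolding separates_def using \<rho> by blast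
    have close: "dist x (\<theta>'', \<eta>) < \<delta>" if "dist \<theta>' \<theta>'' < \<rho>" for \<theta>''
    proof -
      have "dist x (\<theta>'', \<eta>) \<le> dist \<theta> \<theta>'' + dist \<xi> \<eta>"
        unfolding x(1) dist_Pair_Pair by (rule sqrt_sum_squares_le_sum) auto
      then show ?thesis
        using that \<theta>'(1) \<eta>(3) dist_triangle[of \<theta> \<theta>'' \<theta>'] by (simp add: \<rho>_def)
    qed
    \<comment> \<open>The image of \<open>x\<close> cannot be within e/2 of both images of the
      separated pair; this is where the constant is halved.\<close>
    have "dist ((f ^^ n) x) ((f ^^ n) (\<theta>\<^sub>1, \<eta>)) > e / 2 \<or> dist ((f ^^ n) x) ((f ^^ n) (\<theta>\<^sub>2, \<eta>)) > e / 2"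
      using n(3) dist_triangle3[of "(f ^^ n) (\<theta>\<^sub>1, \<eta>)" "(f ^^ n) (\<theta>\<^sub>2, \<eta>)" "(f ^^ n) x"] by linarith
    then obtain \<theta>'' where "dist \<theta>' \<theta>'' < \<rho>" "dist ((f ^^ n) x) ((f ^^ n) (\<theta>'', \<eta>)) > e / 2"
      using n(1,2) by blast
    then show "\<exists>n. \<exists>y\<in>UNIV \<times> {a..b}. dist x y < \<delta> \<and> dist ((f ^^ n) x) ((f ^^ n) y) > e / 2"
      using close[of \<theta>''] \<eta>(1) by (intro exI[of _ n] bexI[of _ "(\<theta>'', \<eta>)"]) auto
  qed
qed

end

theorem corollary4p5:
  fixes \<omega> a b :: real
    and f :: "circle \<times> real \<Rightarrow> circle \<times> real"
  defines "\<K> \<equiv> global_attractor a b f"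
  assumes "a < b"
    and "qpf_monotone_interval_map \<omega> a b f"
    and "pinched \<K>"
    and "(\<not> continuous_on UNIV (upper_graph \<K>) \<and> \<not> continuous_on UNIV (lower_graph \<K>)) \<or>
         (\<not> continuous_on UNIV (upper_graph \<K>) \<and> continuous_on UNIV (lower_graph \<K>) \<and>
            ((\<forall>\<theta>. lower_graph \<K> \<theta> = a) \<or> (\<forall>\<theta>. lower_graph \<K> \<theta> = b))) \<or>
         (\<not> continuous_on UNIV (lower_graph \<K>) \<and> continuous_on UNIV (upper_graph \<K>) \<and>
            ((\<forall>\<theta>. upper_graph \<K> \<theta> = a) \<or> (\<forall>\<theta>. upper_graph \<K> \<theta> = b)))"
  shows "sensitive_dependence_on (UNIV \<times> {a..b}) f"
proof -
  interpret qpf_map \<omega> a b f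
    using assms(2,3) by unfold_locales
  note pinched = \<open>pinched \<K>\<close>[unfolded \<K>_def]
  note graphs = assms(5)[unfolded \<K>_def]
  have const: "continuous_on UNIV g" if "\<And>\<theta>. g \<theta> = c" for g :: "circle \<Rightarrow> real" and c
    by (simp add: that)
  \<comment> \<open>A lower graph at height b would force the upper graph to be constantly b as
    well, contradicting its discontinuity.\<close>
  have "\<forall>\<theta>. lower \<theta> = a" if "continuous_on UNIV lower"
  proof -
    have "\<not> (\<forall>\<theta>. lower \<theta> = b)"
    proof
      assume "\<forall>\<theta>. lower \<theta> = b"
      then have "upper \<theta> = b" for \<theta>
        using lower_le_upper[of \<theta>] upper_in[of \<theta>] by simp
      then show False
        using const[of upper b] graphs that by blast
    qed
    with that graphs show ?thesis by blast
  qed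
  \<comment> \<open>If the lower graph is the line at height a, no point of the annulus lies below
    it and any constant, here 1, will do.\<close>
  then have below: "\<exists>e>0. \<forall>\<theta>. \<forall>\<xi>\<in>{a..b}. \<xi> < lower \<theta> \<longrightarrow> separates f e \<theta> \<xi>"
    using separation_below_lower by (cases "continuous_on UNIV lower") (auto intro!: exI[of _ 1])
  have "\<forall>\<theta>. upper \<theta> = b" if "continuous_on UNIV upper"
  proof -
    have "\<not> (\<forall>\<theta>. upper \<theta> = a)"
    proof
      assume "\<forall>\<theta>. upper \<theta> = a"
      then have "lower \<theta> = a" for \<theta>
        using lower_le_upper[of \<theta>] lower_in[of \<theta>] by simp
      then show False
        using const[of lower a] graphs that by blast
    qed
    with that graphs show ?thesis by blast
  qed
  then have above: "\<exists>e>0. \<forall>\<theta>. \<forall>\<xi>\<in>{a..b}. upper \<theta> < \<xi> \<longrightarrow> separates f e \<theta> \<xi>"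
    using separation_above_upper by (cases "continuous_on UNIV upper") (auto intro!: exI[of _ 1])
  from pinched above below show ?thesis by (rule sensitive_dependence)
qed

end
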